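(* For integers $n\ge 0$ and $k\ge 0$, let $m(n,k)$ denote the number of maximal independent sets of size exactly $k$ in the meta-pentagonal cactus $M(n)$. Then, as formal power series in $x,y$, $$\sum_{n\ge 0}\sum_{k\ge 0} m(n,k)\,x^n y^k \;=\; 1+\frac{-11x^2y^4+5xy^2+2x^3y^6+2x^3y^5-x^2y^3}{1-4xy^2-xy+3x^2y^3+4x^2y^4-2x^3y^5}.$$
   Context: For $n\ge 1$, the meta-pentagonal cactus $M(n)$ is the graph formed by a chain of $n$ 5-cycles $B_1,\dots,B_n$, where for each $1\le i\le n-1$ the consecutive cycles $B_i$ and $B_{i+1}$ share exactly one vertex, non-consecutive cycles share no vertex, every vertex lies in at most two cycles, and for each $2\le i\le n-1$ the two shared (cut) vertices of $B_i$ are at distance two in $B_i$. $M(0)$ is the empty graph, so $m(0,0)=1$ and $m(0,k)=0$ for $k\ge1$. An independent set is maximal if no further vertex can be added while keeping it independent. *)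

theory Defs
  imports
    "Graph_Theory.Graph_Theory"
    "HOL-Computational_Algebra.Formal_Power_Series"
begin

text \<open>
  A finite simple graph is a \<^const>\<open>pair_graph\<close>: an edge between \<open>u\<close> and \<open>v\<close> is the pair of arcs
  \<open>(u, v)\<close>, \<open>(v, u)\<close>.
\<close>

definition is_cycle_graph :: "nat \<Rightarrow> 'a pair_pre_digraph \<Rightarrow> bool" where
  "is_cycle_graph k C \<longleftrightarrow> k \<ge> 3 \<and>
     (\<exists>v. inj_on v {..<k} \<and> pverts C = v ` {..<k} \<and>
       parcs C = {(v i, v j) | i j. i < k \<and> j < k \<and> (j = (i + 1) mod k \<or> i = (j + 1) mod k)})"

definition graph_dist :: "'a pair_pre_digraph \<Rightarrow> 'a \<Rightarrow> 'a \<Rightarrow> ereal" where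
  "graph_dist G u v = wf_digraph.\<mu> (with_proj G) (\<lambda>_. 1) u v"

definition meta_pentagonal_cactus :: "nat \<Rightarrow> 'a pair_pre_digraph \<Rightarrow> bool" where
  "meta_pentagonal_cactus n G \<longleftrightarrow>
     (\<exists>B :: nat \<Rightarrow> 'a pair_pre_digraph.
        (\<forall>i\<in>{1..n}. is_cycle_graph 5 (B i)) \<and>
        pverts G = (\<Union>i\<in>{1..n}. pverts (B i)) \<and>
        parcs G = (\<Union>i\<in>{1..n}. parcs (B i)) \<and>
        (\<forall>i\<in>{1..<n}. card (pverts (B i) \<inter> pverts (B (i + 1))) = 1) \<and>
        (\<forall>i\<in>{1..n}. \<forall>j\<in>{1..n}. i + 1 < j \<longrightarrow> pverts (B i) \<inter> pverts (B j) = {}) \<and>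
        (\<forall>x\<in>pverts G. card {i\<in>{1..n}. x \<in> pverts (B i)} \<le> 2) \<and>
        (\<forall>i\<in>{2..<n}. \<forall>u \<in> pverts (B (i - 1)) \<inter> pverts (B i).
           \<forall>w \<in> pverts (B i) \<inter> pverts (B (i + 1)). graph_dist (B i) u w = 2))"

definition independent_set :: "'a pair_pre_digraph \<Rightarrow> 'a set \<Rightarrow> bool" where
  "independent_set G S \<longleftrightarrow> S \<subseteq> pverts G \<and> (\<forall>u\<in>S. \<forall>v\<in>S. (u, v) \<notin> parcs G)"

definition maximal_independent_set :: "'a pair_pre_digraph \<Rightarrow> 'a set \<Rightarrow> bool" where
  "maximal_independent_set G S \<longleftrightarrow>
     independent_set G S \<and> (\<forall>v \<in> pverts G - S. \<not> independent_set G (insert v S))"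

definition mis_count :: "'a pair_pre_digraph \<Rightarrow> nat \<Rightarrow> nat" where
  "mis_count G k = card {S. maximal_independent_set G S \<and> card S = k}"

lemma is_cycle_graph_imp_pair_graph:
  assumes "is_cycle_graph k C"
  shows "pair_graph C"
proof -
  from assms obtain v where k: "k \<ge> 3" and inj: "inj_on v {..<k}" and V: "pverts C = v ` {..<k}"
    and A: "parcs C = {(v i, v j) | i j. i < k \<and> j < k \<and> (j = (i + 1) mod k \<or> i = (j + 1) mod k)}"
    unfolding is_cycle_graph_def by blast
  have sub: "parcs C \<subseteq> pverts C \<times> pverts C" unfolding A V by auto
  have fin: "finite (pverts C)" unfolding V by simp
  have nofix: "(i + 1) mod k \<noteq> i" if "i < k" for i
    using that k by (cases "i + 1 = k") auto
  have loop: "a \<noteq> b" if ab: "(a, b) \<in> parcs C" for a b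
  proof -
    from ab obtain i j where "a = v i" "b = v j" "i < k" "j < k"
      and "j = (i + 1) mod k \<or> i = (j + 1) mod k"
      unfolding A by blast
    moreover from this have "i \<noteq> j" using nofix[of i] nofix[of j] by argo
    ultimately show ?thesis using inj_onD[OF inj, of i j] by auto
  qed
  have "sym (parcs C)" unfolding A sym_def by blast
  then show ?thesis
    using sub fin loop finite_subset[OF sub]
    by unfold_locales (auto simp: symmetric_def)
qed

lemma meta_pentagonal_cactus_imp_pair_graph:
  assumes "meta_pentagonal_cactus n G"
  shows "pair_graph G"
proof -
  from assms obtain B where cyc: "\<forall>i\<in>{1..n}. is_cycle_graph 5 (B i)"
    and V: "pverts G = (\<Union>i\<in>{1..n}. pverts (B i))" and A: "parcs G = (\<Union>i\<in>{1..n}. parcs (B i))"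
    unfolding meta_pentagonal_cactus_def by blast
  have pg: "pair_graph (B i)" if "i \<in> {1..n}" for i
    using that cyc is_cycle_graph_imp_pair_graph by blast
  have sub: "parcs (B i) \<subseteq> pverts (B i) \<times> pverts (B i)" if "i \<in> {1..n}" for i
    using pair_wf_digraph.in_arcsD1[of "B i"] pair_wf_digraph.in_arcsD2[of "B i"] pg[OF that]
    by (auto simp: pair_graph_def pair_digraph_def pair_fin_digraph_def)
  have fin: "finite (pverts (B i))" "finite (parcs (B i))" if "i \<in> {1..n}" for i
    using pg[OF that] by (auto simp: pair_graph_def pair_digraph_def pair_fin_digraph_def
      pair_fin_digraph_axioms_def)
  have loop: "a \<noteq> b" if "(a, b) \<in> parcs G" for a b
  proof -
    from that obtain i where i: "i \<in> {1..n}" "(a, b) \<in> parcs (B i)" unfolding A by blast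
    interpret pair_graph "B i" by (rule pg) fact
    show ?thesis using pair_no_loops[OF i(2)] by simp
  qed
  have "sym (parcs (B i))" if "i \<in> {1..n}" for i
    using pg[OF that] by (auto simp: pair_graph_def pair_pseudo_graph_def pair_sym_digraph_def
      pair_sym_digraph_axioms_def symmetric_def)
  then have "sym (parcs G)" unfolding A by (intro sym_UNION) auto
  moreover have "parcs G \<subseteq> pverts G \<times> pverts G" using sub unfolding A V by blast
  moreover have "finite (pverts G)" "finite (parcs G)" unfolding A V using fin by auto
  ultimately show ?thesis
    using loop by unfold_locales (auto simp: symmetric_def)
qed

lemma graph_dist_eq_2I:
  assumes pg: "pair_graph G" and ne: "u \<noteq> w" and na: "(u, w) \<notin> parcs G"
    and a: "(u, x) \<in> parcs G" "(x, w) \<in> parcs G"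
  shows "graph_dist G u w = 2"
proof -
  interpret pair_graph G by (rule pg)
  have len: "awalk_cost (\<lambda>_. 1) p = real (length p)" for p :: "('a \<times> 'a) list"
    by (induction p) auto
  have "awalk u [(u, x), (x, w)] w"
    using a in_arcsD1 by (auto simp: awalk_def)
  then have "\<mu> (\<lambda>_. 1) u w \<le> ereal (awalk_cost (\<lambda>_. 1) [(u, x), (x, w)])"
    unfolding \<mu>_def by (intro INF_lower) auto
  moreover have "ereal 2 \<le> \<mu> (\<lambda>_. 1) u w"
    unfolding \<mu>_def
  proof (rule INF_greatest)
    fix p assume "p \<in> {p. awalk u p w}"
    then have p: "set p \<subseteq> parcs G" "pcas u p w" by (auto simp: awalk_def)
    have "length p \<ge> 2"
    proof (cases p)
      case Nil then show ?thesis using p ne by simp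
    next
      case (Cons e es)
      then show ?thesis using p na by (cases es) (auto simp: Suc_le_eq)
    qed
    then show "ereal 2 \<le> ereal (awalk_cost (\<lambda>_. 1) p)" by (simp add: len)
  qed
  ultimately show ?thesis by (simp add: graph_dist_def)
qed

text \<open>
  The block \<open>B\<^sub>i\<close> of the witness is the cycle through \<open>0, 1, 4, 2, 3\<close>, shifted by \<open>4 * (i - 1)\<close>; the
  shared vertex of \<open>B\<^sub>i\<close> and \<open>B\<^sub>i\<^sub>+\<^sub>1\<close> is \<open>4 * i\<close>.
\<close>

lemma meta_pentagonal_cactus_exists: "\<exists>G :: nat pair_pre_digraph. meta_pentagonal_cactus n G"
proof -
  define v :: "nat \<Rightarrow> nat \<Rightarrow> nat" where "v i p = 4 * (i - 1) + [0, 1, 4, 2, 3] ! p" for i p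
  define B :: "nat \<Rightarrow> nat pair_pre_digraph" where
    "B i = \<lparr> pverts = v i ` {..<5},
             parcs = {(v i p, v i q) | p q. p < 5 \<and> q < 5 \<and> (q = (p + 1) mod 5 \<or> p = (q + 1) mod 5)} \<rparr>" for i
  have five: "{..<5} = {0, 1, 2, 3, 4 :: nat}" by auto
  have inj: "inj_on (v i) {..<5}" for i
    unfolding five by (simp add: v_def)
  have cyc: "is_cycle_graph 5 (B i)" for i
    unfolding is_cycle_graph_def B_def using inj[of i] by auto
  have V: "pverts (B i) = {4 * (i - 1)..4 * (i - 1) + 4}" for i
    by (auto simp: B_def five v_def)
  have V': "pverts (B i) = {4 * i - 4..4 * i}" if "i \<ge> 1" for i
    using that by (auto simp: V)
  have int: "pverts (B i) \<inter> pverts (B (i + 1)) = {4 * i}" if "i \<ge> 1" for i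
    using that by (auto simp: V')
  have dist: "graph_dist (B i) (4 * (i - 1)) (4 * i) = 2" if "i \<ge> 1" for i
  proof (rule graph_dist_eq_2I)
    show "pair_graph (B i)" using cyc is_cycle_graph_imp_pair_graph by blast
    show "4 * (i - 1) \<noteq> 4 * i" using that by simp
    have v: "4 * (i - 1) = v i 0" "4 * i = v i 2" using that by (auto simp: v_def)
    show "(4 * (i - 1), 4 * i) \<notin> parcs (B i)"
    proof
      assume "(4 * (i - 1), 4 * i) \<in> parcs (B i)"
      then obtain p q where pq: "v i 0 = v i p" "v i 2 = v i q" "p < 5" "q < 5"
        and or: "q = (p + 1) mod 5 \<or> p = (q + 1) mod 5"
        unfolding v by (auto simp: B_def)
      have "p = 0" "q = 2" using inj_onD[OF inj pq(1)] inj_onD[OF inj pq(2)] pq(3,4) by auto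
      with or show False by simp
    qed
    show "(4 * (i - 1), v i 1) \<in> parcs (B i)" "(v i 1, 4 * i) \<in> parcs (B i)"
      unfolding v by (force simp: B_def)+
  qed
  define G where "G = \<lparr> pverts = (\<Union>i\<in>{1..n}. pverts (B i)), parcs = (\<Union>i\<in>{1..n}. parcs (B i)) \<rparr>"
  have "card {i\<in>{1..n}. x \<in> pverts (B i)} \<le> 2" for x
  proof -
    have "{i\<in>{1..n}. x \<in> pverts (B i)} \<subseteq> {x div 4, x div 4 + 1}"
      by (auto simp: V')
    then have "card {i\<in>{1..n}. x \<in> pverts (B i)} \<le> card {x div 4, x div 4 + 1}"
      by (intro card_mono) auto
    then show ?thesis by simp
  qed
  moreover have "graph_dist (B i) u w = 2"
    if "i \<in> {2..<n}" "u \<in> pverts (B (i - 1)) \<inter> pverts (B i)" "w \<in> pverts (B i) \<inter> pverts (B (i + 1))"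
    for i u w
  proof -
    have "i - 1 \<ge> 1" "i \<ge> 1" "i - 1 + 1 = i" using that(1) by auto
    then have "u = 4 * (i - 1)" "w = 4 * i"
      using that(2,3) int[of "i - 1", OF \<open>i - 1 \<ge> 1\<close>] int[of i, OF \<open>i \<ge> 1\<close>] by auto
    then show ?thesis using dist[of i] \<open>i \<ge> 1\<close> by simp
  qed
  moreover have "pverts (B i) \<inter> pverts (B j) = {}" if "i \<in> {1..n}" "j \<in> {1..n}" "i + 1 < j" for i j
    using that by (auto simp: V')
  moreover have "card (pverts (B i) \<inter> pverts (B (i + 1))) = 1" if "i \<in> {1..<n}" for i
    using that int[of i] by simp
  ultimately have "meta_pentagonal_cactus n G"
    unfolding meta_pentagonal_cactus_def using cyc
    by (intro exI[of _ B]) (simp add: G_def)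
  then show ?thesis by blast
qed

text \<open>
  Power series in \<open>x\<close> and \<open>y\<close> are power series in \<open>x\<close> whose coefficients are power series in \<open>y\<close>.
\<close>

abbreviation fps_x :: "rat fps fps" where "fps_x \<equiv> fps_X"
abbreviation fps_y :: "rat fps fps" where "fps_y \<equiv> fps_const fps_X"

text \<open>
  The coefficient ring \<^typ>\<open>rat fps\<close> is not a field, but division by a series in \<open>x\<close> with constant
  coefficient 1 is still genuine division.
\<close>

lemma fps_fps_divide_eq_iff:
  fixes N D F :: "rat fps fps"
  assumes "fps_nth D 0 = 1"
  shows "N / D = F \<longleftrightarrow> N = F * D"
proof -
  have sd: "subdegree D = 0" using assms by simp
  have inv: "D * inverse D = 1"
    unfolding fps_inverse_def using assms by (intro fps_right_inverse) simp
  have div: "N / D = N * inverse D" by (simp add: fps_divide_def sd)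
  show ?thesis
  proof
    assume "N / D = F"
    then have "F * D = N * (D * inverse D)" by (simp only: div mult_ac)
    then show "N = F * D" by (simp only: inv mult_1_right)
  next
    assume "N = F * D"
    then have "N / D = F * (D * inverse D)" unfolding div by (simp only: mult_ac)
    then show "N / D = F" by (simp only: inv mult_1_right)
  qed
qed

end

theory Submission
  imports Defs
begin

text \<open>
  The cactus \<open>M(n)\<close>, \<open>n \<ge> 1\<close>, arises from a single vertex by \<open>n\<close> times attaching a pentagon
  \<open>u a w b c\<close> at the current root \<open>u\<close> and moving the root to \<open>w\<close>. Count independent sets that
  dominate every vertex outside them except possibly the root, separately according to whether they
  contain the root. If \<open>u\<close> is in the set, the new part is \<open>{w}\<close> or \<open>{b}\<close>; if not, it is
  \<open>{w, c}\<close>, \<open>{a, b}\<close> or \<open>{a, c}\<close>, each of which dominates \<open>u\<close>. So the size generating functions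
  \<open>I\<^sub>n\<close> (root in the set) and \<open>O\<^sub>n\<close> (root outside) satisfy \<open>I\<^sub>n\<^sub>+\<^sub>1 = y I\<^sub>n + y\<^sup>2 O\<^sub>n\<close> and
  \<open>O\<^sub>n\<^sub>+\<^sub>1 = y I\<^sub>n + 2 y\<^sup>2 O\<^sub>n\<close> with \<open>I\<^sub>0 = y\<close>, \<open>O\<^sub>0 = 1\<close>. Every new part contains one of \<open>w, a, b\<close>, so
  for \<open>n \<ge> 1\<close> the root is dominated too and \<open>I\<^sub>n + O\<^sub>n\<close> counts the maximal independent sets.
  The resulting fraction has denominator \<open>1 - x y - 2 x y\<^sup>2 + x\<^sup>2 y\<^sup>3\<close>; the stated one is its
  expansion by \<open>1 - 2 x y\<^sup>2\<close>.
\<close>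

definition pentagon_arcs :: "'a \<Rightarrow> 'a \<Rightarrow> 'a \<Rightarrow> 'a \<Rightarrow> 'a \<Rightarrow> ('a \<times> 'a) set" where
  "pentagon_arcs u a w b c =
     {(u, a), (a, u), (a, w), (w, a), (w, b), (b, w), (b, c), (c, b), (c, u), (u, c)}"

definition attach_pentagon ::
  "'a pair_pre_digraph \<Rightarrow> 'a \<Rightarrow> 'a \<Rightarrow> 'a \<Rightarrow> 'a \<Rightarrow> 'a \<Rightarrow> 'a pair_pre_digraph" where
  "attach_pentagon G u a w b c =
     \<lparr> pverts = pverts G \<union> {a, w, b, c}, parcs = parcs G \<union> pentagon_arcs u a w b c \<rparr>"

inductive pentagon_chain :: "nat \<Rightarrow> 'a pair_pre_digraph \<Rightarrow> 'a \<Rightarrow> bool" where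
  single: "pentagon_chain 0 \<lparr> pverts = {u}, parcs = {} \<rparr> u"
| attach: "pentagon_chain n G u \<Longrightarrow> distinct [a, w, b, c] \<Longrightarrow> {a, w, b, c} \<inter> pverts G = {} \<Longrightarrow>
    pentagon_chain (Suc n) (attach_pentagon G u a w b c) w"

lemma pentagon_chain_graph:
  assumes "pentagon_chain n G w"
  shows "w \<in> pverts G \<and> finite (pverts G) \<and> parcs G \<subseteq> pverts G \<times> pverts G \<and>
    sym (parcs G) \<and> irrefl (parcs G)"
  using assms
proof (induction rule: pentagon_chain.induct)
  case (single u)
  then show ?case by (simp add: sym_def irrefl_def)
next
  case (attach n G u a w b c)
  let ?P = "pentagon_arcs u a w b c"
  have "sym ?P" "irrefl ?P" "?P \<subseteq> insert u {a, w, b, c} \<times> insert u {a, w, b, c}"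
    using attach by (auto simp: pentagon_arcs_def sym_def irrefl_def)
  moreover from this have "sym (parcs G \<union> ?P)" "irrefl (parcs G \<union> ?P)"
    using attach.IH by (auto simp: irrefl_def intro: sym_Un)
  moreover have "parcs G \<union> ?P \<subseteq> (pverts G \<union> {a, w, b, c}) \<times> (pverts G \<union> {a, w, b, c})"
    using attach.IH calculation(3) by blast
  ultimately show ?case
    using attach.IH unfolding attach_pentagon_def by simp
qed

text \<open>The root \<open>w\<close> need not be dominated, since it may still be dominated from the next block.\<close>

definition rooted_mis :: "'a pair_pre_digraph \<Rightarrow> 'a \<Rightarrow> 'a set set" where
  "rooted_mis G w = {S. independent_set G S \<and> (\<forall>v \<in> pverts G - S - {w}. \<exists>s\<in>S. (s, v) \<in> parcs G)}"

lemma maximal_independent_set_iff_rooted_mis: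
  assumes "sym (parcs G)" "irrefl (parcs G)" "w \<in> pverts G"
  shows "maximal_independent_set G S \<longleftrightarrow>
    S \<in> rooted_mis G w \<and> (w \<in> S \<or> (\<exists>s\<in>S. (s, w) \<in> parcs G))"
proof -
  have "\<not> independent_set G (insert v S) \<longleftrightarrow> (\<exists>s\<in>S. (s, v) \<in> parcs G)"
    if "independent_set G S" "v \<in> pverts G" for v
    using that assms unfolding independent_set_def sym_def irrefl_def by blast
  then have "maximal_independent_set G S \<longleftrightarrow>
      independent_set G S \<and> (\<forall>v \<in> pverts G - S. \<exists>s\<in>S. (s, v) \<in> parcs G)"
    unfolding maximal_independent_set_def by blast
  then show ?thesis
    using assms(3) unfolding rooted_mis_def by blast
qed

lemma rooted_mis_attach_pentagon_iff:
  assumes "u \<in> pverts G" "parcs G \<subseteq> pverts G \<times> pverts G"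
    and "distinct [a, w, b, c]" "{a, w, b, c} \<inter> pverts G = {}"
    and "T \<subseteq> pverts G" "R \<subseteq> {a, w, b, c}"
  shows "T \<union> R \<in> rooted_mis (attach_pentagon G u a w b c) w \<longleftrightarrow>
    T \<in> rooted_mis G u \<and>
    (if u \<in> T then R = {w} \<or> R = {b} else R = {w, c} \<or> R = {a, b} \<or> R = {a, c})"
proof -
  let ?G = "attach_pentagon G u a w b c"
  have ne: "u \<noteq> a" "u \<noteq> w" "u \<noteq> b" "u \<noteq> c" using assms by auto
  have ind: "independent_set ?G (T \<union> R) \<longleftrightarrow> independent_set G T \<and>
     \<not> (u \<in> T \<and> a \<in> R) \<and> \<not> (a \<in> R \<and> w \<in> R) \<and> \<not> (w \<in> R \<and> b \<in> R) \<and>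
     \<not> (b \<in> R \<and> c \<in> R) \<and> \<not> (c \<in> R \<and> u \<in> T)"
    using assms ne unfolding independent_set_def attach_pentagon_def pentagon_arcs_def
    by simp blast
  have dom_old: "(\<exists>s\<in>T \<union> R. (s, v) \<in> parcs ?G) \<longleftrightarrow> (\<exists>s\<in>T. (s, v) \<in> parcs G)"
    if "v \<in> pverts G" "v \<noteq> u" for v
    using that assms unfolding attach_pentagon_def pentagon_arcs_def by auto
  have dom_new:
    "(\<exists>s\<in>T \<union> R. (s, a) \<in> parcs ?G) \<longleftrightarrow> u \<in> T \<or> w \<in> R"
    "(\<exists>s\<in>T \<union> R. (s, b) \<in> parcs ?G) \<longleftrightarrow> w \<in> R \<or> c \<in> R"
    "(\<exists>s\<in>T \<union> R. (s, c) \<in> parcs ?G) \<longleftrightarrow> b \<in> R \<or> u \<in> T"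
    using assms ne unfolding attach_pentagon_def pentagon_arcs_def by auto
  have dom_u: "(\<exists>s\<in>T \<union> R. (s, u) \<in> parcs ?G) \<longleftrightarrow>
      (\<exists>s\<in>T. (s, u) \<in> parcs G) \<or> a \<in> R \<or> c \<in> R"
    using assms ne unfolding attach_pentagon_def pentagon_arcs_def by auto
  have verts: "pverts ?G - (T \<union> R) - {w} = (pverts G - T) \<union> ({a, b, c} - R)"
    using assms by (auto simp: attach_pentagon_def)
  have "T \<union> R \<in> rooted_mis ?G w \<longleftrightarrow> independent_set ?G (T \<union> R) \<and>
    (\<forall>v \<in> pverts G - T - {u}. \<exists>s\<in>T. (s, v) \<in> parcs G) \<and>
    (u \<in> T \<or> (\<exists>s\<in>T. (s, u) \<in> parcs G) \<or> a \<in> R \<or> c \<in> R) \<and>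
    (a \<in> R \<or> u \<in> T \<or> w \<in> R) \<and> (b \<in> R \<or> w \<in> R \<or> c \<in> R) \<and> (c \<in> R \<or> b \<in> R \<or> u \<in> T)"
  proof -
    have "(\<forall>v \<in> pverts G - T. \<exists>s\<in>T \<union> R. (s, v) \<in> parcs ?G) \<longleftrightarrow>
      (\<forall>v \<in> pverts G - T - {u}. \<exists>s\<in>T \<union> R. (s, v) \<in> parcs ?G) \<and>
      (u \<in> T \<or> (\<exists>s\<in>T \<union> R. (s, u) \<in> parcs ?G))"
      using assms(1) by blast
    also have "(\<forall>v \<in> pverts G - T - {u}. \<exists>s\<in>T \<union> R. (s, v) \<in> parcs ?G) \<longleftrightarrow>
      (\<forall>v \<in> pverts G - T - {u}. \<exists>s\<in>T. (s, v) \<in> parcs G)"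
      using dom_old by (intro ball_cong) auto
    finally have old: "(\<forall>v \<in> pverts G - T. \<exists>s\<in>T \<union> R. (s, v) \<in> parcs ?G) \<longleftrightarrow>
      (\<forall>v \<in> pverts G - T - {u}. \<exists>s\<in>T. (s, v) \<in> parcs G) \<and>
      (u \<in> T \<or> (\<exists>s\<in>T. (s, u) \<in> parcs G) \<or> a \<in> R \<or> c \<in> R)"
      unfolding dom_u .
    have "(\<forall>v \<in> {a, b, c} - R. \<exists>s\<in>T \<union> R. (s, v) \<in> parcs ?G) \<longleftrightarrow>
      (a \<in> R \<or> (\<exists>s\<in>T \<union> R. (s, a) \<in> parcs ?G)) \<and>
      (b \<in> R \<or> (\<exists>s\<in>T \<union> R. (s, b) \<in> parcs ?G)) \<and>
      (c \<in> R \<or> (\<exists>s\<in>T \<union> R. (s, c) \<in> parcs ?G))"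
      by blast
    then show ?thesis
      unfolding rooted_mis_def mem_Collect_eq verts ball_Un old dom_new by blast
  qed
  also have "\<dots> \<longleftrightarrow> T \<in> rooted_mis G u \<and>
     (if u \<in> T then a \<notin> R \<and> c \<notin> R \<and> (w \<in> R \<longleftrightarrow> b \<notin> R)
      else (a \<notin> R \<and> w \<in> R \<and> b \<notin> R \<and> c \<in> R) \<or> (a \<in> R \<and> w \<notin> R \<and> b \<in> R \<and> c \<notin> R) \<or>
        (a \<in> R \<and> w \<notin> R \<and> b \<notin> R \<and> c \<in> R))"
    unfolding rooted_mis_def ind mem_Collect_eq by argo
  also have "(if u \<in> T then a \<notin> R \<and> c \<notin> R \<and> (w \<in> R \<longleftrightarrow> b \<notin> R)
      else (a \<notin> R \<and> w \<in> R \<and> b \<notin> R \<and> c \<in> R) \<or> (a \<in> R \<and> w \<notin> R \<and> b \<in> R \<and> c \<notin> R) \<or>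
        (a \<in> R \<and> w \<notin> R \<and> b \<notin> R \<and> c \<in> R)) \<longleftrightarrow>
    (if u \<in> T then R = {w} \<or> R = {b} else R = {w, c} \<or> R = {a, b} \<or> R = {a, c})"
  proof -
    have eqs: "R = {w} \<longleftrightarrow> a \<notin> R \<and> w \<in> R \<and> b \<notin> R \<and> c \<notin> R"
      "R = {b} \<longleftrightarrow> a \<notin> R \<and> w \<notin> R \<and> b \<in> R \<and> c \<notin> R"
      "R = {w, c} \<longleftrightarrow> a \<notin> R \<and> w \<in> R \<and> b \<notin> R \<and> c \<in> R"
      "R = {a, b} \<longleftrightarrow> a \<in> R \<and> w \<notin> R \<and> b \<in> R \<and> c \<notin> R"
      "R = {a, c} \<longleftrightarrow> a \<in> R \<and> w \<notin> R \<and> b \<notin> R \<and> c \<in> R"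
      using assms(3,6) by auto
    show ?thesis unfolding eqs by argo
  qed
  finally show ?thesis .
qed

definition rooted_in :: "'a pair_pre_digraph \<Rightarrow> 'a \<Rightarrow> 'a set set" where
  "rooted_in G w = {S \<in> rooted_mis G w. w \<in> S}"

definition rooted_out :: "'a pair_pre_digraph \<Rightarrow> 'a \<Rightarrow> 'a set set" where
  "rooted_out G w = {S \<in> rooted_mis G w. w \<notin> S}"

lemma rooted_mis_subset: "S \<in> rooted_mis G w \<Longrightarrow> S \<subseteq> pverts G"
  by (simp add: rooted_mis_def independent_set_def)

lemma rooted_attach_pentagon:
  assumes "u \<in> pverts G" "parcs G \<subseteq> pverts G \<times> pverts G"
    and "distinct [a, w, b, c]" "{a, w, b, c} \<inter> pverts G = {}"
  shows "rooted_in (attach_pentagon G u a w b c) w =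
      (\<lambda>T. T \<union> {w}) ` rooted_in G u \<union> (\<lambda>T. T \<union> {w, c}) ` rooted_out G u" (is ?in)
    and "rooted_out (attach_pentagon G u a w b c) w =
      (\<lambda>T. T \<union> {b}) ` rooted_in G u \<union>
      ((\<lambda>T. T \<union> {a, b}) ` rooted_out G u \<union> (\<lambda>T. T \<union> {a, c}) ` rooted_out G u)" (is ?out)
proof -
  let ?G = "attach_pentagon G u a w b c"
  note iff = rooted_mis_attach_pentagon_iff[OF assms]
  have new: "w \<notin> T" if "T \<in> rooted_mis G u" for T
    using rooted_mis_subset[OF that] assms(4) by blast
  have split: "\<exists>T R. S = T \<union> R \<and> T \<in> rooted_mis G u \<and>
      (if u \<in> T then R = {w} \<or> R = {b} else R = {w, c} \<or> R = {a, b} \<or> R = {a, c})"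
    if "S \<in> rooted_mis ?G w" for S
  proof (intro exI)
    show "S = S \<inter> pverts G \<union> S \<inter> {a, w, b, c} \<and> S \<inter> pverts G \<in> rooted_mis G u \<and>
      (if u \<in> S \<inter> pverts G then S \<inter> {a, w, b, c} = {w} \<or> S \<inter> {a, w, b, c} = {b}
       else S \<inter> {a, w, b, c} = {w, c} \<or> S \<inter> {a, w, b, c} = {a, b} \<or> S \<inter> {a, w, b, c} = {a, c})"
    proof
      show "S = S \<inter> pverts G \<union> S \<inter> {a, w, b, c}"
        using rooted_mis_subset[OF that] by (auto simp: attach_pentagon_def)
      then show "S \<inter> pverts G \<in> rooted_mis G u \<and>
        (if u \<in> S \<inter> pverts G then S \<inter> {a, w, b, c} = {w} \<or> S \<inter> {a, w, b, c} = {b}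
         else S \<inter> {a, w, b, c} = {w, c} \<or> S \<inter> {a, w, b, c} = {a, b} \<or> S \<inter> {a, w, b, c} = {a, c})"
        using iff[of "S \<inter> pverts G" "S \<inter> {a, w, b, c}"] that
        by (metis Int_lower2)
    qed
  qed
  have comp: "T \<union> {w} \<in> rooted_mis ?G w" "T \<union> {b} \<in> rooted_mis ?G w" if "T \<in> rooted_in G u" for T
    using that iff[of T "{w}"] iff[of T "{b}"] rooted_mis_subset[of T]
    by (auto simp: rooted_in_def)
  have comp': "T \<union> {w, c} \<in> rooted_mis ?G w" "T \<union> {a, b} \<in> rooted_mis ?G w"
    "T \<union> {a, c} \<in> rooted_mis ?G w" if "T \<in> rooted_out G u" for T
    using that iff[of T "{w, c}"] iff[of T "{a, b}"] iff[of T "{a, c}"] rooted_mis_subset[of T]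
    by (auto simp: rooted_out_def)
  show ?in
  proof (intro equalityI subsetI)
    fix S assume "S \<in> rooted_in ?G w"
    then have S: "S \<in> rooted_mis ?G w" "w \<in> S" by (auto simp: rooted_in_def)
    then obtain T R where T: "S = T \<union> R" "T \<in> rooted_mis G u"
      and R: "if u \<in> T then R = {w} \<or> R = {b} else R = {w, c} \<or> R = {a, b} \<or> R = {a, c}"
      using split by blast
    have "w \<in> R" using new[OF T(2)] S(2) T(1) by blast
    show "S \<in> (\<lambda>T. T \<union> {w}) ` rooted_in G u \<union> (\<lambda>T. T \<union> {w, c}) ` rooted_out G u"
    proof (cases "u \<in> T")
      case True
      then have "R = {w}" "T \<in> rooted_in G u"
        using R T \<open>w \<in> R\<close> assms(3) by (auto simp: rooted_in_def)
      then show ?thesis using T(1) by blast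
    next
      case False
      then have "R = {w, c}" "T \<in> rooted_out G u"
        using R T \<open>w \<in> R\<close> assms(3) by (auto simp: rooted_out_def)
      then show ?thesis using T(1) by blast
    qed
  next
    fix S assume "S \<in> (\<lambda>T. T \<union> {w}) ` rooted_in G u \<union> (\<lambda>T. T \<union> {w, c}) ` rooted_out G u"
    then show "S \<in> rooted_in ?G w"
      using comp comp' by (auto simp: rooted_in_def[of ?G])
  qed
  show ?out
  proof (intro equalityI subsetI)
    fix S assume "S \<in> rooted_out ?G w"
    then have S: "S \<in> rooted_mis ?G w" "w \<notin> S" by (auto simp: rooted_out_def)
    then obtain T R where T: "S = T \<union> R" "T \<in> rooted_mis G u"
      and R: "if u \<in> T then R = {w} \<or> R = {b} else R = {w, c} \<or> R = {a, b} \<or> R = {a, c}"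
      using split by blast
    have "w \<notin> R" using S(2) T(1) by blast
    show "S \<in> (\<lambda>T. T \<union> {b}) ` rooted_in G u \<union>
      ((\<lambda>T. T \<union> {a, b}) ` rooted_out G u \<union> (\<lambda>T. T \<union> {a, c}) ` rooted_out G u)"
    proof (cases "u \<in> T")
      case True
      then have "R = {b}" "T \<in> rooted_in G u"
        using R T \<open>w \<notin> R\<close> by (auto simp: rooted_in_def)
      then show ?thesis using T(1) by blast
    next
      case False
      then have "R = {a, b} \<or> R = {a, c}" "T \<in> rooted_out G u"
        using R T \<open>w \<notin> R\<close> by (auto simp: rooted_out_def)
      then show ?thesis using T(1) by blast
    qed
  next
    fix S assume "S \<in> (\<lambda>T. T \<union> {b}) ` rooted_in G u \<union>
      ((\<lambda>T. T \<union> {a, b}) ` rooted_out G u \<union> (\<lambda>T. T \<union> {a, c}) ` rooted_out G u)"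
    then show "S \<in> rooted_out ?G w"
      using comp comp' new assms(3)
      by (auto simp: rooted_out_def[of ?G]) (auto simp: rooted_in_def rooted_out_def)
  qed
qed

definition size_gf :: "'a set set \<Rightarrow> rat fps" where
  "size_gf F = (\<Sum>S\<in>F. fps_X ^ card S)"

lemma size_gf_eq_Abs_fps:
  assumes "finite F"
  shows "size_gf F = Abs_fps (\<lambda>k. of_nat (card {S \<in> F. card S = k}))"
proof (rule fps_ext)
  fix k
  have "fps_nth (size_gf F) k = (\<Sum>S\<in>F. if k = card S then 1 else 0)"
    unfolding size_gf_def fps_sum_nth by (intro sum.cong) auto
  also have "\<dots> = of_nat (card {S \<in> F. card S = k})"
    using assms by (simp add: sum.If_cases Int_def eq_commute)
  finally show "fps_nth (size_gf F) k =
    fps_nth (Abs_fps (\<lambda>k. of_nat (card {S \<in> F. card S = k}))) k" by simp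
qed

lemma size_gf_Un:
  "finite F \<Longrightarrow> finite H \<Longrightarrow> F \<inter> H = {} \<Longrightarrow> size_gf (F \<union> H) = size_gf F + size_gf H"
  unfolding size_gf_def by (rule sum.union_disjoint)

lemma size_gf_image_Un:
  assumes "finite V" "F \<subseteq> Pow V" "finite R" "R \<inter> V = {}"
  shows "size_gf ((\<lambda>T. T \<union> R) ` F) = fps_X ^ card R * size_gf F"
proof -
  have inj: "inj_on (\<lambda>T. T \<union> R) F"
    using assms(2,4) by (intro inj_onI) blast
  have "card (T \<union> R) = card R + card T" if "T \<in> F" for T
    using that assms by (subst card_Un_disjoint) (auto intro: finite_subset)
  then show ?thesis
    unfolding size_gf_def sum.reindex[OF inj] sum_distrib_left
    by (intro sum.cong) (auto simp: power_add)
qed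

fun in_gf :: "nat \<Rightarrow> rat fps" and out_gf :: "nat \<Rightarrow> rat fps" where
  "in_gf 0 = fps_X"
| "out_gf 0 = 1"
| "in_gf (Suc n) = fps_X * in_gf n + fps_X^2 * out_gf n"
| "out_gf (Suc n) = fps_X * in_gf n + 2 * fps_X^2 * out_gf n"

lemma size_gf_pentagon_chain:
  assumes "pentagon_chain n G w"
  shows "size_gf (rooted_in G w) = in_gf n \<and> size_gf (rooted_out G w) = out_gf n"
  using assms
proof (induction rule: pentagon_chain.induct)
  case (single u)
  have "rooted_in \<lparr>pverts = {u}, parcs = {}\<rparr> u = {{u}}" "rooted_out \<lparr>pverts = {u}, parcs = {}\<rparr> u = {{}}"
    unfolding rooted_in_def rooted_out_def rooted_mis_def independent_set_def by auto
  then show ?case by (simp add: size_gf_def)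
next
  case (attach n G u a w b c)
  let ?I = "rooted_in G u" and ?O = "rooted_out G u"
  note G = pentagon_chain_graph[OF attach.hyps(1)]
  have sub: "?I \<subseteq> Pow (pverts G)" "?O \<subseteq> Pow (pverts G)"
    by (auto simp: rooted_in_def rooted_out_def dest: rooted_mis_subset)
  have fin: "finite ?I" "finite ?O"
    using sub G by (auto intro: finite_subset)
  have new: "x \<notin> T" if "T \<in> ?I \<or> T \<in> ?O" "x \<in> {a, w, b, c}" for x T
    using that sub attach.hyps by blast
  have dist: "a \<noteq> w" "a \<noteq> b" "a \<noteq> c" "w \<noteq> b" "w \<noteq> c" "b \<noteq> c"
    using attach.hyps by auto
  have img: "size_gf ((\<lambda>T. T \<union> R) ` F) = fps_X ^ card R * size_gf F"
    if "F \<subseteq> Pow (pverts G)" "R \<subseteq> {a, w, b, c}" for F R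
    using that G attach.hyps by (intro size_gf_image_Un[of "pverts G"]) (auto intro: finite_subset)
  have "(\<lambda>T. T \<union> {w}) ` ?I \<inter> (\<lambda>T. T \<union> {w, c}) ` ?O = {}"
    using new dist by blast
  moreover have "(\<lambda>T. T \<union> {a, b}) ` ?O \<inter> (\<lambda>T. T \<union> {a, c}) ` ?O = {}"
    using new dist by blast
  moreover have "(\<lambda>T. T \<union> {b}) ` ?I \<inter> ((\<lambda>T. T \<union> {a, b}) ` ?O \<union> (\<lambda>T. T \<union> {a, c}) ` ?O) = {}"
    using new dist by blast
  moreover have "rooted_in (attach_pentagon G u a w b c) w =
      (\<lambda>T. T \<union> {w}) ` ?I \<union> (\<lambda>T. T \<union> {w, c}) ` ?O"
    "rooted_out (attach_pentagon G u a w b c) w =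
      (\<lambda>T. T \<union> {b}) ` ?I \<union> ((\<lambda>T. T \<union> {a, b}) ` ?O \<union> (\<lambda>T. T \<union> {a, c}) ` ?O)"
    using G attach.hyps by (intro rooted_attach_pentagon; simp)+
  ultimately show ?case
    using fin sub dist attach.IH
    by (simp add: size_gf_Un img del: Un_insert_right) (simp add: algebra_simps power2_eq_square)
qed

lemma mis_count_pentagon_chain:
  assumes "pentagon_chain (Suc n) G w"
  shows "Abs_fps (\<lambda>k. of_nat (mis_count G k)) = in_gf (Suc n) + out_gf (Suc n)"
proof -
  note G = pentagon_chain_graph[OF assms]
  have fin: "finite (rooted_mis G w)"
    using G rooted_mis_subset by (metis PowI finite_Pow_iff finite_subset subsetI)
  have "(w \<in> S \<or> (\<exists>s\<in>S. (s, w) \<in> parcs G))" if S: "S \<in> rooted_mis G w" for S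
    using assms
  proof cases
    case (attach H u a b c)
    have "S \<in> rooted_in G w \<or> S \<in> rooted_out G w"
      using S by (auto simp: rooted_in_def rooted_out_def)
    moreover have "u \<in> pverts H" "parcs H \<subseteq> pverts H \<times> pverts H"
      using pentagon_chain_graph[of n H u] attach by auto
    ultimately have "w \<in> S \<or> a \<in> S \<or> b \<in> S"
      using rooted_attach_pentagon[of u H a w b c] attach by auto
    moreover have "(a, w) \<in> parcs G" "(b, w) \<in> parcs G"
      unfolding attach(1) by (simp_all add: attach_pentagon_def pentagon_arcs_def)
    ultimately show ?thesis by blast
  qed
  then have mis: "maximal_independent_set G S \<longleftrightarrow> S \<in> rooted_mis G w" for S
    using maximal_independent_set_iff_rooted_mis[of G w S] G by blast
  have "rooted_mis G w = rooted_in G w \<union> rooted_out G w" "rooted_in G w \<inter> rooted_out G w = {}"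
    by (auto simp: rooted_in_def rooted_out_def)
  then have "size_gf (rooted_mis G w) = in_gf (Suc n) + out_gf (Suc n)"
    using size_gf_pentagon_chain[OF assms] size_gf_Un fin by (metis finite_Un)
  then show ?thesis
    using size_gf_eq_Abs_fps[OF fin] by (simp add: mis_count_def mis)
qed

lemma graph_dist_eq_2D:
  assumes "pair_graph G" "graph_dist G u w = 2" "u \<in> pverts G"
  shows "u \<noteq> w" "(u, w) \<notin> parcs G"
proof -
  interpret pair_graph G by fact
  have le: "graph_dist G u w \<le> ereal (awalk_cost (\<lambda>_. 1) p)" if "awalk u p w" for p
    unfolding graph_dist_def \<mu>_def using that by (intro INF_lower) auto
  show "u \<noteq> w"
  proof
    assume "u = w"
    then have "awalk u [] w" using assms(3) by (simp add: awalk_def)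
    from le[OF this] assms(2) show False by simp
  qed
  show "(u, w) \<notin> parcs G"
  proof
    assume "(u, w) \<in> parcs G"
    then have "awalk u [(u, w)] w" using assms(3) by (simp add: awalk_def)
    from le[OF this] assms(2) show False by simp
  qed
qed

definition is_pentagon :: "'a pair_pre_digraph \<Rightarrow> 'a \<Rightarrow> 'a \<Rightarrow> 'a \<Rightarrow> 'a \<Rightarrow> 'a \<Rightarrow> bool" where
  "is_pentagon C u a w b c \<longleftrightarrow> distinct [u, a, w, b, c] \<and> pverts C = {u, a, w, b, c} \<and>
     parcs C = pentagon_arcs u a w b c"

lemma is_pentagon_rotate: "is_pentagon C u a w b c \<Longrightarrow> is_pentagon C a w b c u"
  by (auto simp: is_pentagon_def pentagon_arcs_def)

lemma is_pentagon_reflect: "is_pentagon C u a w b c \<Longrightarrow> is_pentagon C w a u c b"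
  by (auto simp: is_pentagon_def pentagon_arcs_def)

lemma is_cycle_graph_5_imp_pentagon:
  assumes "is_cycle_graph 5 C"
  obtains u a w b c where "is_pentagon C u a w b c"
proof -
  from assms obtain v where inj: "inj_on v {..<5}" and V: "pverts C = v ` {..<5::nat}"
    and A: "parcs C = {(v i, v j) | i j. i < 5 \<and> j < 5 \<and> (j = (i + 1) mod 5 \<or> i = (j + 1) mod 5)}"
    unfolding is_cycle_graph_def by blast
  have five: "{..<5} = {0, 1, 2, 3, 4 :: nat}" by auto
  have "{(i, j). i < 5 \<and> j < 5 \<and> (j = (i + 1) mod 5 \<or> i = (j + 1) mod 5)} =
      pentagon_arcs 0 1 2 3 (4::nat)" (is "?I = _")
  proof -
    have "?I = (\<lambda>i. (i, (i + 1) mod 5)) ` {..<5} \<union> (\<lambda>i. ((i + 1) mod 5, i)) ` {..<5}"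
      by auto
    also have "\<dots> = pentagon_arcs 0 1 2 3 4"
      unfolding five pentagon_arcs_def by auto
    finally show ?thesis .
  qed
  moreover have "parcs C = map_prod v v ` ?I"
    unfolding A by (auto simp: image_iff)
  ultimately have "parcs C = pentagon_arcs (v 0) (v 1) (v 2) (v 3) (v 4)"
    by (simp add: pentagon_arcs_def)
  moreover have "distinct [v 0, v 1, v 2, v 3, v 4]"
    using inj unfolding five by auto
  ultimately have "is_pentagon C (v 0) (v 1) (v 2) (v 3) (v 4)"
    unfolding is_pentagon_def V five by simp
  then show ?thesis by (rule that)
qed

lemma is_pentagon_through:
  assumes "is_cycle_graph 5 C" "u \<in> pverts C"
  obtains a w b c where "is_pentagon C u a w b c"
proof -
  obtain p q r s t where "is_pentagon C p q r s t"
    using is_cycle_graph_5_imp_pentagon[OF assms(1)] .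
  moreover from this have "u \<in> {p, q, r, s, t}"
    using assms(2) by (simp add: is_pentagon_def)
  ultimately show ?thesis
    using that is_pentagon_rotate by (metis empty_iff insert_iff)
qed

lemma is_pentagon_through_nonadjacent:
  assumes "is_cycle_graph 5 C" "u \<in> pverts C" "w \<in> pverts C" "u \<noteq> w" "(u, w) \<notin> parcs C"
  obtains a b c where "is_pentagon C u a w b c"
proof -
  obtain p q r s where P: "is_pentagon C u p q r s"
    using is_pentagon_through[OF assms(1,2)] .
  then have "w = q \<or> w = r"
    using assms by (auto simp: is_pentagon_def pentagon_arcs_def)
  moreover have "is_pentagon C u s r q p"
    using P by (auto simp: is_pentagon_def pentagon_arcs_def)
  ultimately show ?thesis using that P by blast
qed

lemma meta_pentagonal_cactus_imp_chain:
  assumes "meta_pentagonal_cactus (Suc n) G"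
  obtains w where "pentagon_chain (Suc n) G w"
proof -
  from assms obtain B where cyc: "\<forall>i\<in>{1..Suc n}. is_cycle_graph 5 (B i)"
    and V: "pverts G = (\<Union>i\<in>{1..Suc n}. pverts (B i))"
    and A: "parcs G = (\<Union>i\<in>{1..Suc n}. parcs (B i))"
    and one: "\<forall>i\<in>{1..<Suc n}. card (pverts (B i) \<inter> pverts (B (i + 1))) = 1"
    and disj: "\<forall>i\<in>{1..Suc n}. \<forall>j\<in>{1..Suc n}. i + 1 < j \<longrightarrow> pverts (B i) \<inter> pverts (B j) = {}"
    and dist: "\<forall>i\<in>{2..<Suc n}. \<forall>u \<in> pverts (B (i - 1)) \<inter> pverts (B i).
           \<forall>w \<in> pverts (B i) \<inter> pverts (B (i + 1)). graph_dist (B i) u w = 2"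
    unfolding meta_pentagonal_cactus_def by blast
  define H where "H m = \<lparr> pverts = (\<Union>i\<in>{1..m}. pverts (B i)), parcs = (\<Union>i\<in>{1..m}. parcs (B i)) \<rparr>"
    for m
  define far where "far m w \<longleftrightarrow>
    (\<forall>u \<in> pverts (B (m - 1)) \<inter> pverts (B m). m \<ge> 2 \<longrightarrow> u \<noteq> w \<and> (u, w) \<notin> parcs (B m))" for m w
  have chain: "pentagon_chain (Suc m) (H (Suc m)) w"
    if "m \<le> n" "w \<in> pverts (B (Suc m))" "far (Suc m) w" for m w
    using that
  proof (induction m arbitrary: w)
    case 0
    have "is_cycle_graph 5 (B (Suc 0))" using cyc by simp
    then obtain a u c b where "is_pentagon (B (Suc 0)) w a u c b"
      using is_pentagon_through 0 by metis
    then have P: "is_pentagon (B (Suc 0)) u a w b c" by (rule is_pentagon_reflect)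
    have "H (Suc 0) = attach_pentagon \<lparr>pverts = {u}, parcs = {}\<rparr> u a w b c"
      using P by (auto simp: H_def attach_pentagon_def is_pentagon_def)
    moreover have "pentagon_chain (Suc 0) \<dots> w"
      using P by (intro attach single) (auto simp: is_pentagon_def)
    ultimately show ?case by simp
  next
    case (Suc m)
    have "card (pverts (B (Suc m)) \<inter> pverts (B (Suc (Suc m)))) = 1"
      using one Suc.prems(1) by simp
    then obtain u where u: "pverts (B (Suc m)) \<inter> pverts (B (Suc (Suc m))) = {u}"
      by (rule card_1_singletonE)
    have "far (Suc m) u"
      unfolding far_def
    proof (intro ballI impI conjI)
      fix t assume t: "t \<in> pverts (B (Suc m - 1)) \<inter> pverts (B (Suc m))" "2 \<le> Suc m"
      have "graph_dist (B (Suc m)) t u = 2"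
        using dist t u Suc.prems(1) by auto
      moreover have "pair_graph (B (Suc m))"
        using cyc Suc.prems(1) by (intro is_cycle_graph_imp_pair_graph[of 5]) simp
      ultimately show "t \<noteq> u" "(t, u) \<notin> parcs (B (Suc m))"
        using graph_dist_eq_2D[of "B (Suc m)" t u] t(1) by simp_all
    qed
    then have IH: "pentagon_chain (Suc m) (H (Suc m)) u"
      using Suc.IH[of u] Suc.prems(1) u by auto
    have "is_cycle_graph 5 (B (Suc (Suc m)))" using cyc Suc.prems(1) by simp
    moreover have "u \<noteq> w" "(u, w) \<notin> parcs (B (Suc (Suc m)))"
      using Suc.prems(3) u by (auto simp: far_def)
    ultimately obtain a b c where P: "is_pentagon (B (Suc (Suc m))) u a w b c"
      using is_pentagon_through_nonadjacent Suc.prems(2) u by (metis Int_iff singletonI)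
    have ivl: "{1..Suc (Suc m)} = insert (Suc (Suc m)) {1..Suc m}" by auto
    have uH: "u \<in> pverts (H (Suc m))" using pentagon_chain_graph[OF IH] by blast
    have "H (Suc (Suc m)) = attach_pentagon (H (Suc m)) u a w b c"
      using P uH unfolding H_def ivl
      by (auto simp: attach_pentagon_def is_pentagon_def)
    moreover have "pverts (H (Suc m)) \<inter> pverts (B (Suc (Suc m))) \<subseteq> {u}"
    proof
      fix x assume x: "x \<in> pverts (H (Suc m)) \<inter> pverts (B (Suc (Suc m)))"
      then obtain i where i: "i \<in> {1..Suc m}" "x \<in> pverts (B i)" by (auto simp: H_def)
      have "i = Suc m"
      proof (rule ccontr)
        assume "i \<noteq> Suc m"
        then have "pverts (B i) \<inter> pverts (B (Suc (Suc m))) = {}"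
          using disj i Suc.prems(1) by simp
        then show False using x i by blast
      qed
      then show "x \<in> {u}" using u x i by blast
    qed
    then have "{a, w, b, c} \<inter> pverts (H (Suc m)) = {}"
      using P by (auto simp: is_pentagon_def)
    ultimately show ?case
      using pentagon_chain.attach[OF IH, of a w b c] P by (simp add: is_pentagon_def)
  qed
  have "\<exists>w \<in> pverts (B (Suc n)). far (Suc n) w"
  proof (cases "n = 0")
    case True
    have "is_cycle_graph 5 (B (Suc n))" using cyc by simp
    then obtain p q r s t where "is_pentagon (B (Suc n)) p q r s t"
      by (rule is_cycle_graph_5_imp_pentagon)
    then have "p \<in> pverts (B (Suc n))" by (simp add: is_pentagon_def)
    then show ?thesis using True by (auto simp: far_def)
  next
    case False
    then have "card (pverts (B n) \<inter> pverts (B (Suc n))) = 1" using one by simp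
    then obtain u where u: "pverts (B n) \<inter> pverts (B (Suc n)) = {u}"
      by (rule card_1_singletonE)
    have "is_cycle_graph 5 (B (Suc n))" "u \<in> pverts (B (Suc n))" using cyc u by auto
    then obtain a w b c where P: "is_pentagon (B (Suc n)) u a w b c"
      by (rule is_pentagon_through)
    then have "far (Suc n) w"
      using u by (auto simp: far_def is_pentagon_def pentagon_arcs_def)
    then show ?thesis using P by (auto simp: is_pentagon_def)
  qed
  moreover have "H (Suc n) = G" unfolding H_def using V A by simp
  ultimately show ?thesis using chain[of n] that by auto
qed

lemma mis_count_meta_pentagonal_cactus_0:
  assumes "meta_pentagonal_cactus 0 G"
  shows "Abs_fps (\<lambda>k. of_nat (mis_count G k)) = (1 :: rat fps)"
proof -
  have "pverts G = {}" using assms by (auto simp: meta_pentagonal_cactus_def)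
  then have "{S. maximal_independent_set G S \<and> card S = k} = (if k = 0 then {{}} else {})" for k
    by (auto simp: maximal_independent_set_def independent_set_def)
  then show ?thesis by (intro fps_ext) (simp add: mis_count_def)
qed

theorem theorem2p12:
  fixes M :: "nat \<Rightarrow> 'a pair_pre_digraph"
  assumes "\<And>n. meta_pentagonal_cactus n (M n)"
  shows "Abs_fps (\<lambda>n. Abs_fps (\<lambda>k. of_nat (mis_count (M n) k))) =
    1 + (- 11 * fps_x^2 * fps_y^4 + 5 * fps_x * fps_y^2 + 2 * fps_x^3 * fps_y^6
          + 2 * fps_x^3 * fps_y^5 - fps_x^2 * fps_y^3)
        / (1 - 4 * fps_x * fps_y^2 - fps_x * fps_y + 3 * fps_x^2 * fps_y^3
          + 4 * fps_x^2 * fps_y^4 - 2 * fps_x^3 * fps_y^5)"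
    (is "?F = 1 + ?N / ?D")
proof -
  define I O' where "I = Abs_fps in_gf" and "O' = Abs_fps out_gf"
  define x y where "x = fps_x" and "y = fps_y"
  have two: "(2 :: rat fps fps) = fps_const 2" by (simp add: numeral_fps_const)
  have I: "I = y + x * (y * I + y^2 * O')"
  proof (rule fps_ext)
    fix n show "fps_nth I n = fps_nth (y + x * (y * I + y^2 * O')) n"
      by (cases n) (simp_all add: I_def O'_def x_def y_def)
  qed
  have O': "O' = 1 + x * (y * I + 2 * y^2 * O')"
  proof (rule fps_ext)
    fix n show "fps_nth O' n = fps_nth (1 + x * (y * I + 2 * y^2 * O')) n"
      by (cases n) (simp_all add: I_def O'_def x_def y_def two mult.assoc)
  qed
  have F: "?F = I + O' - y"
  proof (rule fps_ext)
    fix n show "fps_nth ?F n = fps_nth (I + O' - y) n"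
    proof (cases n)
      case 0
      then show ?thesis
        using mis_count_meta_pentagonal_cactus_0[of "M 0"] assms[of 0]
        by (simp add: I_def O'_def y_def)
    next
      case (Suc m)
      obtain w where "pentagon_chain (Suc m) (M (Suc m)) w"
        using meta_pentagonal_cactus_imp_chain assms by blast
      from mis_count_pentagon_chain[OF this] show ?thesis
        using Suc by (simp add: I_def O'_def y_def)
    qed
  qed
  let ?E = "1 - x * y - 2 * x * y^2 + x^2 * y^3"
  have EI: "?E * I = y * (1 - 2 * x * y^2) + x * y^2" and EO: "?E * O' = 1 - x * y + x * y^2"
    using I O' by algebra+
  have "?N = (1 - 2 * x * y^2) * (?E * I + ?E * O' - ?E * (1 + y))"
    unfolding EI EO x_def[symmetric] y_def[symmetric] by algebra
  also have "\<dots> = (?F - 1) * ?D"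
    unfolding F x_def[symmetric] y_def[symmetric] by algebra
  finally have "?N / ?D = ?F - 1"
    by (subst fps_fps_divide_eq_iff) (simp_all add: power2_eq_square)
  then show ?thesis by simp
qed

end
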